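(* Let $U$ be a vector space over a field $\Phi$ of characteristic different from $2,3,5$, and let $L,R,Q$ be linear operators on $U$ satisfying $$R^{2}-Q^{2}+LR-R=0,\quad RQ-QR+LQ-Q=0,\quad LR=RL,\quad LQ+QL-2Q=0,$$ $$(R-2L-1)(R-L)=0,\quad (R-L)(R+Q+L-1)=0. \qquad( * )$$ Then $U$ is a direct sum of six subspaces $$U=U_{00}\oplus U_{01}\oplus U_{\frac12\frac12}\oplus U_{11}^{+}\oplus U_{11}^{-}\oplus U_{13}^{-}$$ such that: (i) $La=\lambda a$ and $Ra=\mu a$ for every $a$ in the summand with index $\lambda\mu$; (ii) $Qa=0$ for every $a$ in a summand with index $\lambda\mu$, $\lambda\neq1$; (iii) $Qa=-3a$ if $a\in U_{13}^{-}$; (iv) $Qa=\pm a$ for all $a\in U_{11}^{\pm}$. Conversely, if a vector space $U$ over $\Phi$ is presented as a direct sum $U=U_{00}\oplus U_{01}\oplus U_{\frac12\frac12}\oplus U_{11}^{+}\oplus U_{11}^{-}\oplus U_{13}^{-}$ of six subspaces (possibly zero) and three linear operators $L,R,Q$ on $U$ are defined by (i)–(iv), then the system of equations $( * )$ is fulfilled.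
   Context: In equations of operators, $1$ denotes the identity operator. *)

theory Defs
  imports Complex_Main "HOL-Library.Function_Algebras"
begin

datatype summand = U00 | U01 | Uhh | U11p | U11m | U13m
  \<comment> \<open>\<open>h\<close> stands for \<open>1/2\<close>, and \<open>p\<close>, \<open>m\<close> for the superscripts \<open>+\<close>, \<open>-\<close>\<close>

lemma UNIV_summand: "(UNIV :: summand set) = {U00, U01, Uhh, U11p, U11m, U13m}"
  using summand.exhaust by auto

instance summand :: finite
  by standard (simp add: UNIV_summand)

fun ix_lambda :: "summand \<Rightarrow> 'a::field" where
  "ix_lambda U00 = 0"
| "ix_lambda U01 = 0"
| "ix_lambda Uhh = 1 / 2"
| "ix_lambda U11p = 1"
| "ix_lambda U11m = 1"
| "ix_lambda U13m = 1"

fun ix_mu :: "summand \<Rightarrow> 'a::field" where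
  "ix_mu U00 = 0"
| "ix_mu U01 = 1"
| "ix_mu Uhh = 1 / 2"
| "ix_mu U11p = 1"
| "ix_mu U11m = 1"
| "ix_mu U13m = 3"

text \<open>Internal direct sum of a finite family of subspaces; the zero subspace is allowed.\<close>

definition direct_sum_decomp ::
    "('a::field \<Rightarrow> 'b::ab_group_add \<Rightarrow> 'b) \<Rightarrow> ('i::finite \<Rightarrow> 'b set) \<Rightarrow> bool" where
  "direct_sum_decomp scale V \<longleftrightarrow>
     (\<forall>i. module.subspace scale (V i)) \<and>
     (\<forall>u. \<exists>!v. (\<forall>i. v i \<in> V i) \<and> u = (\<Sum>i\<in>UNIV. v i))"

text \<open>
  Operators act on the left, so a product of operators is \<open>\<circ>\<close> and the identity operator is
  \<open>id\<close> (not the constant function \<open>1\<close> of \<open>HOL-Library.Function_Algebras\<close>); sums,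
  differences and \<open>0\<close> are pointwise.
\<close>

definition operator_system ::
    "('a::field \<Rightarrow> 'b::ab_group_add \<Rightarrow> 'b) \<Rightarrow>
      ('b \<Rightarrow> 'b) \<Rightarrow> ('b \<Rightarrow> 'b) \<Rightarrow> ('b \<Rightarrow> 'b) \<Rightarrow> bool" where
  "operator_system scale L R Q \<longleftrightarrow>
     (R \<circ> R) - (Q \<circ> Q) + (L \<circ> R) - R = 0 \<and>
     (R \<circ> Q) - (Q \<circ> R) + (L \<circ> Q) - Q = 0 \<and>
     L \<circ> R = R \<circ> L \<and>
     (L \<circ> Q) + (Q \<circ> L) - (scale 2 \<circ> Q) = 0 \<and>
     (R - (scale 2 \<circ> L) - id) \<circ> (R - L) = 0 \<and>
     (R - L) \<circ> (R + Q + L - id) = 0"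

definition acts_by_indices ::
    "('a::field \<Rightarrow> 'b::ab_group_add \<Rightarrow> 'b) \<Rightarrow> (summand \<Rightarrow> 'b set) \<Rightarrow>
      ('b \<Rightarrow> 'b) \<Rightarrow> ('b \<Rightarrow> 'b) \<Rightarrow> ('b \<Rightarrow> 'b) \<Rightarrow> bool" where
  "acts_by_indices scale V L R Q \<longleftrightarrow>
     (\<forall>i. \<forall>a\<in>V i. L a = scale (ix_lambda i) a \<and> R a = scale (ix_mu i) a) \<and>
     (\<forall>i. (ix_lambda i :: 'a) \<noteq> 1 \<longrightarrow> (\<forall>a\<in>V i. Q a = 0)) \<and>
     (\<forall>a\<in>V U13m. Q a = scale (- 3) a) \<and>
     (\<forall>a\<in>V U11p. Q a = a) \<and>
     (\<forall>a\<in>V U11m. Q a = - a)"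

end

theory Submission
  imports Defs
begin

text \<open>
  Put \<open>D = R - L\<close> and \<open>M = L - 1\<close>. The system says that \<open>M\<close> anticommutes with \<open>Q\<close>, commutes with
  \<open>D\<close>, and lets one rewrite \<open>D\<^sup>2\<close>, \<open>D Q\<close>, \<open>Q D\<close> and \<open>Q\<^sup>2\<close>. Resolving \<open>Q (Q D) = Q\<^sup>2 D\<close> in two ways
  gives \<open>3 (M\<^sup>2 - M) Q = M (M + 1) (2 M + 1)\<close>. Its left side therefore commutes with \<open>M\<close>, whereas
  \<open>Q\<close> anticommutes with \<open>M\<close>; this and a multiplication by \<open>Q\<close> force \<open>M Q = 0\<close> and hence
  \<open>L (L - 1) (2 L - 1) = 0\<close>. Now \<open>L\<close>, \<open>R\<close>, \<open>Q\<close> generate a commutative algebra spanned by \<open>1\<close>, \<open>L\<close>,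
  \<open>L\<^sup>2\<close>, \<open>D\<close>, \<open>L D\<close>, \<open>Q\<close>, and the projections onto the six joint eigenspaces are obtained by
  interpolation.
\<close>

section \<open>Consequences of the relations in a ring\<close>

text \<open>The sort is weaker than \<^class>\<open>ring_1\<close>, which would exclude the zero space by \<open>0 \<noteq> 1\<close>.\<close>

lemma operator_relations_consequences:
  fixes L R Q D :: "'r::{ring,semiring_numeral}"
  assumes tf: "\<And>x::'r. 6 * x = 0 \<Longrightarrow> x = 0"
    and 1: "R * R - Q * Q + L * R - R = 0"
    and 2: "R * Q - Q * R + L * Q - Q = 0"
    and 3: "L * R = R * L"
    and 4: "L * Q + Q * L - 2 * Q = 0"
    and 5: "(R - 2 * L - 1) * (R - L) = 0"
    and 6: "(R - L) * (R + Q + L - 1) = 0"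
  defines "D \<equiv> R - L"
  shows "L * Q = Q" "Q * L = Q" "D * L = L * D" "L * L * D = L * D" "D * D = L * D + D"
    "D * Q = - 3 * (L * D)" "Q * D = - 3 * (L * D)"
    "Q * Q = 2 * (L * L) - L + 4 * (L * D)"
    "2 * (L * L * L) = 3 * (L * L) - L"
proof -
  have R: "R = D + L" by (simp add: D_def)
  \<comment> \<open>With numerals unfolded into sums, identities between noncommutative words are
    settled by additive cancellation.\<close>
  have n: "2 * x = x + x" "3 * x = x + x + x" "4 * x = x + x + x + x" "6 * x = x + x + x + x + x + x"
    "8 * x = x + x + x + x + x + x + x + x" "14 * x = x + x + x + x + x + x + x + x + x + x + x + x + x + x"
    "x * 2 = x + x" "x * 3 = x + x + x" for x :: 'r
  proof -
    have "(2::'r) = 1 + 1" "(3::'r) = 1 + 1 + 1" "(4::'r) = 1 + 1 + 1 + 1"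
      "(6::'r) = 1 + 1 + 1 + 1 + 1 + 1" "(8::'r) = 1 + 1 + 1 + 1 + 1 + 1 + 1 + 1"
      "(14::'r) = 1 + 1 + 1 + 1 + 1 + 1 + 1 + 1 + 1 + 1 + 1 + 1 + 1 + 1"
      by simp_all
    then show "2 * x = x + x" "3 * x = x + x + x" "4 * x = x + x + x + x" "6 * x = x + x + x + x + x + x"
    "8 * x = x + x + x + x + x + x + x + x" "14 * x = x + x + x + x + x + x + x + x + x + x + x + x + x + x"
    "x * 2 = x + x" "x * 3 = x + x + x"
      by (simp_all only: distrib_left distrib_right mult_1_left mult_1_right)
  qed
  have t3: "x = 0" if "3 * x = 0" for x :: 'r
    by (rule tf) (use that in \<open>simp add: n\<close>)
  have t2: "x = 0" if "2 * x = 0" for x :: 'r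
    by (rule tf) (use that in \<open>simp add: n\<close>)
  \<comment> \<open>Primed variants act inside right-nested products, so that simp keeps words in normal form.\<close>
  show DL: "D * L = L * D"
    using 3 by (simp add: D_def algebra_simps)
  have DL': "D * (L * x) = L * (D * x)" for x by (metis DL mult.assoc)
  show DD: "D * D = L * D + D"
    using 5 unfolding R by (simp add: algebra_simps DL DL' n)
  show DQ: "D * Q = - 3 * (L * D)"
    using 6 unfolding R by (simp add: algebra_simps DL DL' n DD eq_neg_iff_add_eq_0)
  have DQ': "D * (Q * x) = - 3 * (L * (D * x))" for x
    using DQ by (metis mult.assoc)
  have QL: "Q * L = 2 * Q - L * Q"
    using 4 by (simp add: algebra_simps)
  \<comment> \<open>Multiply the anticommutation relation by \<open>D\<close> on the left: each of
    its three terms becomes a multiple of \<open>L * L * D\<close> or \<open>L * D\<close> via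
    \<open>DQ\<close>.\<close>
  have "6 * (L * L * D - L * D) = 0"
  proof -
    have "D * (L * Q + Q * L) = D * (2 * Q)" using 4 by simp
    then show ?thesis by (simp add: algebra_simps n DL DL' DQ DQ')
  qed
  from tf[OF this] show LLD: "L * L * D = L * D" by simp
  show QQ: "Q * Q = 2 * (L * L) - L + 4 * (L * D)"
    using 1 unfolding R by (simp add: algebra_simps n DL DL' DD)
  define M where "M = L - 1"
  have L: "L = M + 1" by (simp add: M_def)
  have QM: "Q * M = - (M * Q)" using QL by (simp add: M_def algebra_simps n)
  have QM': "Q * (M * x) = - (M * (Q * x))" for x
    by (metis QM mult.assoc mult_minus_left)
  have DM: "D * M = M * D" using DL by (simp add: M_def algebra_simps)
  have DM': "D * (M * x) = M * (D * x)" for x by (metis DM mult.assoc)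
  have MMD: "M * (M * D) = - (M * D)"
    using LLD by (simp add: L algebra_simps eq_neg_iff_add_eq_0)
  have QD: "Q * D = 3 * (M * Q) - 3 * (M * D) - 3 * D"
    using 2 unfolding R by (simp add: algebra_simps n DQ QL) (simp add: L algebra_simps n)
  have QQM: "Q * Q = 2 * (M * M) + 3 * M + 1 + 4 * (M * D) + 4 * D"
    unfolding QQ by (simp add: L algebra_simps n)
  have DDM: "D * D = M * D + 2 * D" using DD by (simp add: L algebra_simps n)
  note nf = algebra_simps n QM QM' QD QQM DM DM' DDM MMD
  have "3 * (3 * (M * M * Q - M * Q) - M * (M + 1) * (2 * M + 1)) = 0"
  proof -
    have "Q * (Q * D) = Q * Q * D" by (simp add: mult.assoc)
    then show ?thesis unfolding QD QQM
      by (simp add: nf)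
  qed
  from t3[OF this] have k: "3 * (M * M * Q - M * Q) = M * (M + 1) * (2 * M + 1)" by simp
  have "6 * (M * M * M * Q - M * M * Q) = 0"
  proof -
    have "M * (M * (M + 1) * (2 * M + 1)) = (M * (M + 1) * (2 * M + 1)) * M"
      by (simp add: algebra_simps n)
    then show ?thesis unfolding k[symmetric] by (simp add: nf)
  qed
  from tf[OF this] have MMMQ: "M * (M * (M * Q)) = M * (M * Q)" by (simp add: mult.assoc)
  have M4: "M * (M * (M + 1) * (2 * M + 1)) = 0"
    unfolding k[symmetric] by (simp add: nf MMMQ)
  \<comment> \<open>Multiply \<open>k\<close> by \<open>Q\<close> on the right and write
    \<open>p\<close> for its right side. Since \<open>M * (M + 1) * D = 0\<close>, the formula for
    \<open>Q * Q\<close> turns the left side into \<open>3 * (M - 1) * p\<close>; \<open>M4\<close>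
    kills \<open>M * p\<close>, and \<open>k\<close> trades \<open>3 * p\<close> back for terms in
    \<open>Q\<close>.\<close>
  have e: "14 * (M * (M * Q)) = 8 * (M * Q)"
  proof -
    have kQ: "3 * (M * M * Q - M * Q) * Q = M * (M + 1) * (2 * M + 1) * Q"
      unfolding k ..
    have "14 * (M * (M * Q)) - 8 * (M * Q) =
        (M * (M + 1) * (2 * M + 1) * Q - 3 * (M * M * Q - M * Q) * Q)
        + 3 * (M * (M * (M + 1) * (2 * M + 1)))
        + 3 * (3 * (M * M * Q - M * Q) - M * (M + 1) * (2 * M + 1))"
      by (simp add: nf MMMQ)
    also have "\<dots> = 0" unfolding kQ M4 k by simp
    finally show ?thesis by simp
  qed
  \<comment> \<open>By \<open>MMMQ\<close>, this reads
    \<open>14 * M * M * Q = 8 * M * M * Q\<close>. So \<open>M * M * Q\<close> vanishes, and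
    \<open>e\<close> leaves \<open>8 * M * Q = 0\<close>.\<close>
  have "M * (14 * (M * (M * Q))) = M * (8 * (M * Q))" unfolding e ..
  then have "6 * (M * (M * Q)) = 0" by (simp add: nf MMMQ)
  from tf[OF this] have "2 * (2 * (2 * (M * Q))) = 0"
    using e by (simp add: n add.assoc)
  then have MQ: "M * Q = 0" by (blast intro: t2)
  show LQ: "L * Q = Q" using MQ by (simp add: L distrib_right)
  show "Q * L = Q" using QL LQ by (simp add: n)
  show "Q * D = - 3 * (L * D)" unfolding QD L using MQ by (simp add: algebra_simps)
  have "M * (M + 1) * (2 * M + 1) = 0" using k MQ by (simp add: mult.assoc)
  then show "2 * (L * L * L) = 3 * (L * L) - L"
    by (simp add: M_def algebra_simps n)
qed

section \<open>Additive endomorphisms\<close>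

text \<open>Makes operators elements of a ring type, to which the ring lemma applies. Maps are
  additive rather than linear so that the type does not depend on \<open>scale\<close>; the
  coefficients of the system are integers, hence ring numerals.\<close>

typedef (overloaded) ('b::ab_group_add) add_endo = "{f :: 'b \<Rightarrow> 'b. \<forall>x y. f (x + y) = f x + f y}"
  morphisms apply_endo Endo
  by (rule exI[of _ "\<lambda>x. x"]) simp

setup_lifting type_definition_add_endo

instantiation add_endo :: (ab_group_add) "{ring,semiring_numeral}"
begin

lift_definition zero_add_endo :: "'a add_endo" is "\<lambda>_. 0" by simp
lift_definition one_add_endo :: "'a add_endo" is "\<lambda>x. x" by simp
lift_definition plus_add_endo :: "'a add_endo \<Rightarrow> 'a add_endo \<Rightarrow> 'a add_endo"
  is "\<lambda>f g x. f x + g x" by (simp add: algebra_simps)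
lift_definition minus_add_endo :: "'a add_endo \<Rightarrow> 'a add_endo \<Rightarrow> 'a add_endo"
  is "\<lambda>f g x. f x - g x" by (simp add: algebra_simps)
lift_definition uminus_add_endo :: "'a add_endo \<Rightarrow> 'a add_endo"
  is "\<lambda>f x. - f x" by (simp add: algebra_simps)
lift_definition times_add_endo :: "'a add_endo \<Rightarrow> 'a add_endo \<Rightarrow> 'a add_endo"
  is "\<lambda>f g x. f (g x)" by simp

instance
  by standard (transfer; simp add: fun_eq_iff algebra_simps)+

end

lemma add_endo_eqI: "(\<And>x. apply_endo f x = apply_endo g x) \<Longrightarrow> f = g"
  by (metis apply_endo_inject ext)

lemmas apply_endo_simps [simp] = zero_add_endo.rep_eq one_add_endo.rep_eq plus_add_endo.rep_eq
  minus_add_endo.rep_eq uminus_add_endo.rep_eq times_add_endo.rep_eq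

section \<open>Decomposition into joint eigenspaces\<close>

text \<open>The eigenvalue of \<open>Q\<close> prescribed by (ii)--(iv).\<close>

fun ix_kappa :: "summand \<Rightarrow> 'a::field" where
  "ix_kappa U11p = 1"
| "ix_kappa U11m = - 1"
| "ix_kappa U13m = - 3"
| "ix_kappa _ = 0"

context vector_space
begin

lemma apply_endo_numeral [simp]: "apply_endo (numeral k) x = scale (numeral k) x"
  by (induction k) (simp_all only: numeral.simps apply_endo_simps scale_left_distrib scale_one)

text \<open>The \<open>P i\<close> supply a decomposition; it is unique because \<open>P j\<close>
  applied to any other one picks out its \<open>j\<close>-th component.\<close>

lemma direct_sum_decompI:
  fixes V :: "'i::finite \<Rightarrow> 'b set"
  assumes "\<And>i. subspace (V i)"
    and add: "\<And>i. additive (P i)"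
    and mem: "\<And>i u. P i u \<in> V i"
    and sum: "\<And>u. (\<Sum>i\<in>UNIV. P i u) = u"
    and proj: "\<And>i j a. a \<in> V i \<Longrightarrow> P j a = (if i = j then a else 0)"
  shows "direct_sum_decomp scale V"
  unfolding direct_sum_decomp_def
proof (intro conjI allI)
  fix u
  show "\<exists>!v. (\<forall>i. v i \<in> V i) \<and> u = (\<Sum>i\<in>UNIV. v i)"
  proof (rule ex1I[of _ "\<lambda>i. P i u"])
    fix v assume v: "(\<forall>i. v i \<in> V i) \<and> u = (\<Sum>i\<in>UNIV. v i)"
    show "v = (\<lambda>j. P j u)"
    proof
      fix j
      have "P j u = (\<Sum>i\<in>UNIV. P j (v i))" using v additive.sum[OF add] by metis
      also have "\<dots> = (\<Sum>i\<in>UNIV. if i = j then v i else 0)"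
        using v by (intro sum.cong) (auto simp: proj)
      finally show "v j = P j u" by simp
    qed
  qed (simp add: mem sum)
qed (fact assms)

lemma additive_eq_0_if_direct_sum:
  assumes "direct_sum_decomp scale V" "additive f" "\<And>i a. a \<in> V i \<Longrightarrow> f a = 0"
  shows "f = 0"
proof
  fix u
  obtain v where v: "\<And>i. v i \<in> V i" "u = (\<Sum>i\<in>UNIV. v i)"
    using assms(1) unfolding direct_sum_decomp_def by metis
  have "f (v i) = 0" for i using assms(3) v(1) by blast
  then show "f u = 0 u" by (simp add: v(2) additive.sum[OF assms(2)])
qed

text \<open>The ring consequences evaluated at a vector; \<open>6 \<noteq> 0\<close> in the field
  gives the absence of 6-torsion.\<close>

lemma operator_system_consequences:
  assumes char: "(6::'a) \<noteq> 0"
    and lin: "Vector_Spaces.linear scale scale L" "Vector_Spaces.linear scale scale R"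
      "Vector_Spaces.linear scale scale Q"
    and sys: "operator_system scale L R Q"
    and D: "\<And>x. D x = R x - L x"
  shows "L (Q x) = Q x" "Q (L x) = Q x" "D (L x) = L (D x)" "L (L (D x)) = L (D x)"
    "D (D x) = L (D x) + D x" "D (Q x) = scale (- 3) (L (D x))" "Q (D x) = scale (- 3) (L (D x))"
    "Q (Q x) = scale 2 (L (L x)) - L x + scale 4 (L (D x))"
    "scale 2 (L (L (L x))) = scale 3 (L (L x)) - L x"
proof -
  have Endo: "apply_endo (Endo f) = f" if "Vector_Spaces.linear scale scale f" for f
    using module_hom.add[OF Vector_Spaces.linear.axioms(3)[OF that]] by (intro Endo_inverse) simp
  note [simp] = lin[THEN Endo]
  have tf: "e = 0" if "6 * e = 0" for e :: "'b add_endo"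
  proof (rule add_endo_eqI)
    fix x
    have "scale 6 (apply_endo e x) = 0" using arg_cong[OF that, of "\<lambda>e. apply_endo e x"] by simp
    then show "apply_endo e x = apply_endo 0 x" using char by simp
  qed
  have S: "Endo R * Endo R - Endo Q * Endo Q + Endo L * Endo R - Endo R = 0"
    "Endo R * Endo Q - Endo Q * Endo R + Endo L * Endo Q - Endo Q = 0"
    "Endo L * Endo R = Endo R * Endo L"
    "Endo L * Endo Q + Endo Q * Endo L - 2 * Endo Q = 0"
    "(Endo R - 2 * Endo L - 1) * (Endo R - Endo L) = 0"
    "(Endo R - Endo L) * (Endo R + Endo Q + Endo L - 1) = 0"
    using sys unfolding operator_system_def
    by (auto intro!: add_endo_eqI dest!: fun_cong simp: fun_diff_def)
  note T = operator_relations_consequences[OF tf S, THEN arg_cong[of _ _ "\<lambda>e. apply_endo e x"]]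
  from T(1) show "L (Q x) = Q x" by simp
  from T(2) show "Q (L x) = Q x" by simp
  from T(3) show "D (L x) = L (D x)" by (simp add: D)
  from T(4) show "L (L (D x)) = L (D x)" by (simp add: D)
  from T(5) show "D (D x) = L (D x) + D x" by (simp add: D)
  from T(6) show "D (Q x) = scale (- 3) (L (D x))" by (simp add: D)
  from T(7) show "Q (D x) = scale (- 3) (L (D x))" by (simp add: D)
  from T(8) show "Q (Q x) = scale 2 (L (L x)) - L x + scale 4 (L (D x))" by (simp add: D)
  from T(9) show "scale 2 (L (L (L x))) = scale 3 (L (L x)) - L x" by simp
qed

lemma acts_by_indices_iff:
  assumes "(2::'a) \<noteq> 0"
  shows "acts_by_indices scale V L R Q \<longleftrightarrow>
    (\<forall>i. \<forall>a\<in>V i. L a = scale (ix_lambda i) a \<and> R a = scale (ix_mu i) a \<and> Q a = scale (ix_kappa i) a)"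
proof -
  \<comment> \<open>Condition (ii) reaches \<open>Uhh\<close> only because \<open>1 / 2\<close>
    differs from \<open>1\<close>.\<close>
  have h: "(1 / 2 :: 'a) \<noteq> 1"
  proof -
    have "(1::'a) \<noteq> 1 + 1"
      using add_left_cancel[of "1::'a" 0 1] by (simp only: add_0_right zero_neq_one not_False_eq_True)
    then show ?thesis using assms by (simp add: field_simps)
  qed
  have all: "(\<forall>i. P i) \<longleftrightarrow> P U00 \<and> P U01 \<and> P Uhh \<and> P U11p \<and> P U11m \<and> P U13m" for P
    by (metis summand.exhaust)
  show ?thesis unfolding acts_by_indices_def all using h by auto
qed

lemma decomposition_of_operator_system:
  assumes char: "(2::'a) \<noteq> 0" "(3::'a) \<noteq> 0"
    and lin: "Vector_Spaces.linear scale scale L" "Vector_Spaces.linear scale scale R"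
      "Vector_Spaces.linear scale scale Q"
    and sys: "operator_system scale L R Q"
  shows "\<exists>V. direct_sum_decomp scale V \<and> acts_by_indices scale V L R Q"
proof -
  define D where "D x = R x - L x" for x
  have R: "R x = L x + D x" for x by (simp add: D_def)
  note hom = lin[THEN Vector_Spaces.linear.axioms(3)]
  note [simp] = hom[THEN module_hom.add] hom[THEN module_hom.diff] hom[THEN module_hom.scale]
  have [simp]: "D (x + y) = D x + D y" "D (scale c x) = scale c (D x)" for c x y
    by (simp_all add: D_def scale_right_diff_distrib)
  have "(6::'a) = 2 * 3" by simp
  with char have "(6::'a) \<noteq> 0" by (metis mult_eq_0_iff)
  note rels = operator_system_consequences[OF this lin sys D_def]
  have LLL: "L (L (L x)) = scale (3 / 2) (L (L x)) + scale (- (1 / 2)) (L x)" for x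
  proof -
    have "L (L (L x)) = scale (1 / 2) (scale 2 (L (L (L x))))" using char by simp
    also have "\<dots> = scale (3 / 2) (L (L x)) + scale (- (1 / 2)) (L x)"
      unfolding rels(9) by (simp add: scale_right_diff_distrib)
    finally show ?thesis .
  qed
  \<comment> \<open>The general element of the spanned algebra. \<open>LC\<close>, \<open>DC\<close>
    and \<open>QC\<close> form its multiplication table, reducing operator identities to arithmetic
    on six coefficients.\<close>
  define C where "C c0 c1 c2 d0 d1 q x = scale c0 x + scale c1 (L x) + scale c2 (L (L x)) +
    scale d0 (D x) + scale d1 (L (D x)) + scale q (Q x)" for c0 c1 c2 d0 d1 q x
  note expand = scale_left_distrib scale_right_distrib scale_left_diff_distrib scale_right_diff_distrib
  have LC: "L (C c0 c1 c2 d0 d1 q x) = C 0 (c0 - c2 / 2) (c1 + 3 / 2 * c2) 0 (d0 + d1) q x"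
    for c0 c1 c2 d0 d1 q x
    by (simp add: C_def rels(1-8) LLL expand algebra_simps)
  have DC: "D (C c0 c1 c2 d0 d1 q x) = C 0 0 0 (c0 + d0) (c1 + c2 + d0 + 2 * d1 - 3 * q) 0 x"
    for c0 c1 c2 d0 d1 q x
    by (simp add: C_def rels(1-8) expand algebra_simps)
      (simp add: mult.commute flip: scale_left_distrib)
  have QC: "Q (C c0 c1 c2 d0 d1 q x) =
      C 0 (- q) (2 * q) 0 (4 * q - 3 * d0 - 3 * d1) (c0 + c1 + c2) x"
    for c0 c1 c2 d0 d1 q x
    by (simp add: C_def rels(1-8) expand algebra_simps)
  have addC: "C c0 c1 c2 d0 d1 q x + C c0' c1' c2' d0' d1' q' x =
      C (c0 + c0') (c1 + c1') (c2 + c2') (d0 + d0') (d1 + d1') (q + q') x"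
    for c0 c1 c2 d0 d1 q c0' c1' c2' d0' d1' q' x
    by (simp add: C_def expand algebra_simps)
  have scaleC: "scale c (C c0 c1 c2 d0 d1 q x) =
      C (c * c0) (c * c1) (c * c2) (c * d0) (c * d1) (c * q) x"
    for c c0 c1 c2 d0 d1 q x
    by (simp add: C_def expand)
  have zeroC: "C 0 0 0 0 0 0 x = 0" for x
    by (simp add: C_def)
  have uminusC: "- C c0 c1 c2 d0 d1 q x = C (- c0) (- c1) (- c2) (- d0) (- d1) (- q) x"
    for c0 c1 c2 d0 d1 q x
    using scaleC[of "- 1"] by simp
  have "(4::'a) = 2 * 2" by simp
  with char have four: "(4::'a) \<noteq> 0" by (metis mult_eq_0_iff)
  \<comment> \<open>The fraction values needed below, justified over a field of unspecified
    characteristic.\<close>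
  with char have halves: "(4::'a) / 2 = 2" "(6::'a) / 2 = 3" "(12::'a) / 2 = 6"
    "(3::'a) / 2 - 1 / 2 = 1"
    "2 - (3::'a) / 2 = 1 / 2" "1 - (1::'a) / 2 = 1 / 2" "1 / 2 + 1 = (3::'a) / 2"
    "1 / 2 + (1::'a) / 2 = 1" "1 / 2 + (3::'a) / 2 - 3 = - 1"
    "1 - (3::'a) / 2 + 2 / 4 = 0" "(1::'a) / 2 - 2 + 3 / 2 = 0"
    by (simp_all add: field_simps)
  \<comment> \<open>Interpolated at the joint eigenvalues: \<open>P i\<close> takes the value \<open>1\<close> at index \<open>i\<close> and \<open>0\<close> at the others.\<close>
  define P where "P i = (case i of
      U00 \<Rightarrow> C 1 (- 3) 2 (- 1) 1 0
    | U01 \<Rightarrow> C 0 0 0 1 (- 1) 0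
    | Uhh \<Rightarrow> C 0 4 (- 4) 0 0 0
    | U11p \<Rightarrow> C 0 (- 1 / 2) 1 0 (1 / 2) (1 / 2)
    | U11m \<Rightarrow> C 0 (- 1 / 2) 1 0 (- 1) (- 1 / 2)
    | U13m \<Rightarrow> C 0 0 0 0 (1 / 2) 0)" for i
  define V where "V i = {a. L a = scale (ix_lambda i) a \<and> R a = scale (ix_mu i) a \<and>
    Q a = scale (ix_kappa i) a}" for i
  have "direct_sum_decomp scale V"
  proof (rule direct_sum_decompI[of V P])
    show "subspace (V i)" for i
      using hom[THEN module_hom.zero]
      by (auto simp: V_def subspace_def scale_right_distrib mult.commute)
    show "additive (P i)" for i
      by (rule additive.intro, cases i) (simp_all add: P_def C_def expand algebra_simps)
    show "P i u \<in> V i" for i u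
      by (cases i) (simp_all add: V_def P_def R LC DC QC scaleC addC zeroC uminusC halves char)
    show "(\<Sum>i\<in>UNIV. P i u) = u" for u
    proof -
      have "(\<Sum>i\<in>UNIV. P i u) = C 1 0 0 0 0 0 u"
        by (simp add: UNIV_summand P_def addC halves char)
      then show ?thesis by (simp add: C_def)
    qed
    show "P j a = (if i = j then a else 0)" if "a \<in> V i" for i j a
    proof -
      have a: "L a = scale (ix_lambda i) a" "D a = scale (ix_mu i - ix_lambda i) a"
        "Q a = scale (ix_kappa i) a"
        using that by (simp_all add: V_def D_def scale_left_diff_distrib)
      \<comment> \<open>On a joint eigenvector \<open>C\<close> is a scalar, so \<open>P j\<close>
        acts by its interpolated value, 1 or 0.\<close>
      have "C c0 c1 c2 d0 d1 q a = scale (c0 + c1 * ix_lambda i + c2 * (ix_lambda i)\<^sup>2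
          + d0 * (ix_mu i - ix_lambda i) + d1 * ix_lambda i * (ix_mu i - ix_lambda i)
          + q * ix_kappa i) a" for c0 c1 c2 d0 d1 q
        by (simp add: C_def a expand algebra_simps power2_eq_square)
      then show ?thesis
        by (cases i; cases j) (simp_all add: P_def halves char four power2_eq_square)
    qed
  qed
  moreover have "acts_by_indices scale V L R Q"
    using acts_by_indices_iff[OF char(1)] by (simp add: V_def)
  ultimately show ?thesis by blast
qed

text \<open>On each summand, the difference of the two sides of an equation is a polynomial
  \<open>p\<close> in the eigenvalues of \<open>L\<close>, \<open>R\<close>, \<open>Q\<close>; it
  remains to check that \<open>p\<close> vanishes at the six triples.\<close>

lemma operator_system_of_decomposition:
  assumes char: "(2::'a) \<noteq> 0"
    and dec: "direct_sum_decomp scale V"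
    and lin: "Vector_Spaces.linear scale scale L" "Vector_Spaces.linear scale scale R"
      "Vector_Spaces.linear scale scale Q"
    and acts: "acts_by_indices scale V L R Q"
  shows "operator_system scale L R Q"
proof -
  note hom = lin[THEN Vector_Spaces.linear.axioms(3)]
  note [simp] = hom[THEN module_hom.add] hom[THEN module_hom.diff] hom[THEN module_hom.scale]
    hom[THEN module_hom.zero] hom[THEN module_hom.neg]
  have eig: "L a = scale (ix_lambda i) a" "R a = scale (ix_mu i) a" "Q a = scale (ix_kappa i) a"
    if "a \<in> V i" for i a
    using acts that acts_by_indices_iff[OF char] by blast+
  have "(4::'a) = 2 * 2" by simp
  with char have "(4::'a) \<noteq> 0" by (metis mult_eq_0_iff)
  with char have halves: "(2::'a) / 4 = 1 / 2" by (simp add: field_simps)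
  have eq0: "f = 0" if add: "\<And>x y. f (x + y) = f x + f y"
    and scaled: "\<And>i a. L a = scale (ix_lambda i) a \<Longrightarrow> R a = scale (ix_mu i) a \<Longrightarrow> Q a = scale (ix_kappa i) a
      \<Longrightarrow> f a = scale (p (ix_lambda i) (ix_mu i) (ix_kappa i)) a"
    and zero: "\<And>i. p (ix_lambda i) (ix_mu i) (ix_kappa i) = 0"
    for f :: "'b \<Rightarrow> 'b" and p :: "'a \<Rightarrow> 'a \<Rightarrow> 'a \<Rightarrow> 'a"
  proof (rule additive_eq_0_if_direct_sum[OF dec])
    show "additive f" using add by (rule additive.intro)
    show "f a = 0" if "a \<in> V i" for i a
      using scaled[OF eig[OF that]] zero by simp
  qed
  have "(R \<circ> R) - (Q \<circ> Q) + (L \<circ> R) - R = 0"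
    by (rule eq0[where p = "\<lambda>l m k. m * m - k * k + l * m - m"], simp add: algebra_simps,
        simp add: algebra_simps, case_tac i, simp_all add: halves)
  \<comment> \<open>The commutator cancels on eigenvectors, leaving
    \<open>l * k - k\<close>.\<close>
  moreover have "(R \<circ> Q) - (Q \<circ> R) + (L \<circ> Q) - Q = 0"
    by (rule eq0[where p = "\<lambda>l m k. l * k - k"])
      (simp add: algebra_simps, simp add: algebra_simps, case_tac i, simp_all)
  moreover have "(L \<circ> R) - (R \<circ> L) = 0"
    by (rule eq0[where p = "\<lambda>l m k. 0"]) (simp_all add: algebra_simps)
  then have "L \<circ> R = R \<circ> L" by simp
  moreover have "(L \<circ> Q) + (Q \<circ> L) - (scale 2 \<circ> Q) = 0"
    by (rule eq0[where p = "\<lambda>l m k. l * k + k * l - 2 * k"])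
      (simp add: algebra_simps, simp add: mult.commute
        flip: scale_left_distrib scale_left_diff_distrib, case_tac i, simp_all)
  moreover have "(R - (scale 2 \<circ> L) - id) \<circ> (R - L) = 0"
    by (rule eq0[where p = "\<lambda>l m k. (m - 2 * l - 1) * (m - l)"])
      (simp add: algebra_simps, simp add: scale_right_diff_distrib ring_distribs mult.commute mult.left_commute
        flip: scale_left_distrib scale_left_diff_distrib, case_tac i, simp_all)
  moreover have "(R - L) \<circ> (R + Q + L - id) = 0"
    by (rule eq0[where p = "\<lambda>l m k. (m - l) * (m + k + l - 1)"])
      (simp add: algebra_simps, simp add: algebra_simps, case_tac i, simp_all)
  ultimately show ?thesis unfolding operator_system_def by blast
qed

end

theorem theorem1p2:
  fixes scale :: "'a::field \<Rightarrow> 'b::ab_group_add \<Rightarrow> 'b"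
  assumes "vector_space scale"
    and "CHAR('a) \<notin> {2, 3, 5}"
  shows "(\<forall>L R Q. Vector_Spaces.linear scale scale L \<and> Vector_Spaces.linear scale scale R \<and>
              Vector_Spaces.linear scale scale Q \<and> operator_system scale L R Q \<longrightarrow>
            (\<exists>V. direct_sum_decomp scale V \<and> acts_by_indices scale V L R Q)) \<and>
         (\<forall>V L R Q. direct_sum_decomp scale V \<and>
              Vector_Spaces.linear scale scale L \<and> Vector_Spaces.linear scale scale R \<and>
              Vector_Spaces.linear scale scale Q \<and> acts_by_indices scale V L R Q \<longrightarrow>
            operator_system scale L R Q)"
proof -
  \<comment> \<open>Characteristic 0 divides no positive number, and a divisor of 2 or 3 other than
    1 is 2 or 3 itself.\<close>
  have "\<not> CHAR('a) dvd n" if "n \<in> {2, 3}" for n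
  proof
    assume dvd: "CHAR('a) dvd n"
    then have "CHAR('a) \<noteq> 0" using that by (intro notI) auto
    moreover have "CHAR('a) \<le> 3" using that dvd_imp_le[OF dvd] by auto
    ultimately show False using assms(2) CHAR_not_1[where 'a = 'a] by (simp, presburger)
  qed
  then have "(of_nat 2 :: 'a) \<noteq> 0" "(of_nat 3 :: 'a) \<noteq> 0"
    unfolding of_nat_eq_0_iff_char_dvd by simp_all
  then have char: "(2::'a) \<noteq> 0" "(3::'a) \<noteq> 0" by simp_all
  show ?thesis
    using vector_space.decomposition_of_operator_system[OF assms(1) char]
      vector_space.operator_system_of_decomposition[OF assms(1) char(1)]
    by blast
qed

end
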